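(* Let $G$ be a finite commutative group and let $m=p_1^{r_1}p_2^{r_2}\cdots p_j^{r_j}$ be the prime factorization of the integer $m\geq 2$. Set $m_i=m/p_i^{r_i}$ and let $s_i$ be a natural number such that $s_im_i\equiv 1 \pmod{p_i^{r_i}}$ for $i=1,2,\dots,j$. If $\bar{f_i}$ is an idempotent element of the group ring $\mathbb{Z}_{p_i}G$ for $i=1,2,\dots,j$, then, setting $\alpha_i=p_i^{r_i-1}$, the element $$e=s_1m_1f_1^{\alpha_1}+s_2m_2f_2^{\alpha_2}+\cdots+s_jm_jf_j^{\alpha_j}$$ is an idempotent element of the group ring $\mathbb{Z}_{m}G$. Moreover, $$|E(\mathbb{Z}_{m}G)|=|E(\mathbb{Z}_{p_1}G)|\,|E(\mathbb{Z}_{p_2}G)|\cdots|E(\mathbb{Z}_{p_j}G)|.$$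
   Context: $\mathbb{Z}_n$ denotes the ring of integers modulo $n$ and $\mathbb{Z}_nG$ the group ring of $G$ over $\mathbb{Z}_n$. For a commutative ring $A$, $E(A)=\{e\in A : e^2=e\}$ denotes its set of idempotent elements, and $|X|$ denotes the cardinality of a set $X$. In the prime factorization the $p_i$ are distinct primes and $r_i\ge 1$. For each $i$, $f_i$ denotes a representative of $\bar{f_i}$ with integer coefficients (an element of $\mathbb{Z}G$ whose reduction modulo $p_i$ is $\bar{f_i}$), and the expression for $e$ is read in $\mathbb{Z}_mG$ by reducing coefficients modulo $m$. *)

theory Defs
  imports "HOL-Number_Theory.Residues" "HOL-Algebra.IntRing"
begin

text \<open>
  Elements of the group ring \<open>R[G]\<close> are the finitely supported functions from \<open>G\<close> to \<open>R\<close>, made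
  extensional (undefined outside \<open>carrier G\<close>) so that equality of elements is equality of
  functions. The convolution sum ranges over the support of the left factor, so that it is
  finite also for infinite \<open>G\<close>.
\<close>

definition group_ring ::
    "('r, 'x) ring_scheme \<Rightarrow> ('g, 'y) monoid_scheme \<Rightarrow> ('g \<Rightarrow> 'r) ring" where
  "group_ring R G =
    \<lparr>carrier = {a \<in> carrier G \<rightarrow>\<^sub>E carrier R. finite {g \<in> carrier G. a g \<noteq> \<zero>\<^bsub>R\<^esub>}},
     monoid.mult = (\<lambda>a b. \<lambda>g\<in>carrier G.
       (\<Oplus>\<^bsub>R\<^esub>h\<in>{h \<in> carrier G. a h \<noteq> \<zero>\<^bsub>R\<^esub>}. a h \<otimes>\<^bsub>R\<^esub> b (inv\<^bsub>G\<^esub> h \<otimes>\<^bsub>G\<^esub> g))),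
     one = (\<lambda>g\<in>carrier G. if g = \<one>\<^bsub>G\<^esub> then \<one>\<^bsub>R\<^esub> else \<zero>\<^bsub>R\<^esub>),
     zero = (\<lambda>g\<in>carrier G. \<zero>\<^bsub>R\<^esub>),
     add = (\<lambda>a b. \<lambda>g\<in>carrier G. a g \<oplus>\<^bsub>R\<^esub> b g)\<rparr>"

text \<open>
  \<^const>\<open>residue_ring\<close> represents residues modulo \<open>n\<close> by the integers \<open>0, \<dots>, n - 1\<close>; it is the
  ring of integers modulo \<open>n\<close> only for \<open>n \<ge> 2\<close>.
\<close>

abbreviation modular_group_ring ::
    "nat \<Rightarrow> ('g, 'y) monoid_scheme \<Rightarrow> ('g \<Rightarrow> int) ring" where
  "modular_group_ring n G \<equiv> group_ring (residue_ring (int n)) G"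

abbreviation integral_group_ring :: "('g, 'y) monoid_scheme \<Rightarrow> ('g \<Rightarrow> int) ring" where
  "integral_group_ring G \<equiv> group_ring int_ring G"

definition reduce_coeffs ::
    "nat \<Rightarrow> ('g, 'y) monoid_scheme \<Rightarrow> ('g \<Rightarrow> int) \<Rightarrow> 'g \<Rightarrow> int" where
  "reduce_coeffs n G a = (\<lambda>g\<in>carrier G. a g mod int n)"

definition idempotents :: "('a, 'x) ring_scheme \<Rightarrow> 'a set" where
  "idempotents A = {e \<in> carrier A. e [^]\<^bsub>A\<^esub> (2::nat) = e}"

end

theory Submission
  imports Defs
begin

text \<open>
  All arguments take place in the single commutative ring \<open>\<int>G\<close>. Two of its elements have the same
  reduction modulo \<open>n\<close> iff they differ by a multiple of \<open>n\<close>, and reduction respects products, so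
  an idempotent of \<open>\<int>\<^sub>nG\<close> is the same thing as a class of elements \<open>a\<close> with \<open>a\<^sup>2 \<equiv> a\<close> modulo \<open>n\<close>.

  The engine is the ring version of a familiar fact on integers: if \<open>a \<equiv> b\<close> modulo \<open>p\<close>, then
  \<open>a\<^sup>q \<equiv> b\<^sup>q\<close> modulo \<open>p\<^sup>r\<close> for \<open>q = p\<^sup>r\<^sup>-\<^sup>1\<close> (\<open>iterated_power_congruence_lift\<close>). It is used twice.
  Applied to \<open>f\<^sup>2\<close> and \<open>f\<close>, where \<open>f\<close> is idempotent modulo \<open>p\<close>, it says that \<open>f\<^sup>q\<close> is
  idempotent modulo \<open>p\<^sup>r\<close> (\<open>idempotent_lift_prime_power\<close>); moreover \<open>f\<^sup>q \<equiv> f\<close> modulo \<open>p\<close>, so this is a lift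
  of \<open>f\<close>. Applied to two elements idempotent modulo \<open>p\<^sup>r\<close>, which are congruent modulo \<open>p\<^sup>r\<close> to all their
  positive powers, it says that they agree modulo \<open>p\<^sup>r\<close> as soon as they agree modulo \<open>p\<close>
  (\<open>idempotent_unique_prime_power\<close>).

  The rest is the Chinese remainder theorem, coefficient by coefficient. The weight \<open>s\<^sub>im\<^sub>i\<close> is
  \<open>1\<close> modulo \<open>p\<^sub>i\<close> to the power \<open>r\<^sub>i\<close> and \<open>0\<close> modulo the other prime powers, so the weighted sum
  is congruent to the lift of \<open>f\<^sub>i\<close> modulo each prime power, hence idempotent modulo \<open>m\<close>. It reduces to \<open>f\<^sub>i\<close>
  modulo \<open>p\<^sub>i\<close>, which makes the map that sends an idempotent modulo \<open>m\<close> to the tuple of its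
  reductions modulo the primes \<open>p\<^sub>i\<close> surjective; uniqueness of lifts makes it injective
  (\<open>bij_betw_idempotents\<close>), and counting the two sides gives the product formula.
\<close>

section \<open>Powers of congruent elements in a commutative ring\<close>

text \<open>
  The binomial theorem modulo \<open>x\<^sup>2\<close>: passing from exponent \<open>k\<close> to \<open>k + 1\<close> multiplies the linear
  term by \<open>b\<close> and adds one more \<open>x b\<^sup>k\<close> to it, while all terms of second order are absorbed by \<open>v\<close>,
  so no binomial coefficients have to be tracked.
\<close>

lemma (in cring) binomial_first_order:
  assumes [simp]: "b \<in> carrier R" "x \<in> carrier R"
  shows "\<exists>v\<in>carrier R. (b \<oplus> x) [^] Suc k =
    b [^] Suc k \<oplus> [(Suc k)] \<cdot> (x \<otimes> b [^] k) \<oplus> x \<otimes> x \<otimes> v"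
proof (induction k)
  case 0
  show ?case
    by (rule bexI[of _ \<zero>]) (simp_all add: add.nat_pow_Suc)
next
  case (Suc k)
  then obtain v where v [simp]: "v \<in> carrier R"
    and IH: "(b \<oplus> x) [^] Suc k = b [^] Suc k \<oplus> [(Suc k)] \<cdot> (x \<otimes> b [^] k) \<oplus> x \<otimes> x \<otimes> v"
    by blast
  define B N where "B = b [^] k" and "N = [(Suc k)] \<cdot> B"
  have BN [simp]: "B \<in> carrier R" "N \<in> carrier R"
    by (simp_all add: B_def N_def del: add.nat_pow_Suc)
  have lin: "[(Suc k)] \<cdot> (x \<otimes> b [^] k) = x \<otimes> N"
    by (simp add: N_def B_def add_pow_rdistr del: add.nat_pow_Suc)
  have "[(Suc k)] \<cdot> (x \<otimes> b [^] Suc k) = (x \<otimes> N) \<otimes> b"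
    by (simp add: N_def B_def add_pow_rdistr add_pow_ldistr m_assoc del: add.nat_pow_Suc)
  then have lin': "[(Suc (Suc k))] \<cdot> (x \<otimes> b [^] Suc k) = x \<otimes> N \<otimes> b \<oplus> x \<otimes> (B \<otimes> b)"
    by (subst add.nat_pow_Suc) (simp add: B_def)
  have "(b \<oplus> x) [^] Suc (Suc k) = (B \<otimes> b \<oplus> x \<otimes> N \<oplus> x \<otimes> x \<otimes> v) \<otimes> (b \<oplus> x)"
    using IH lin by (subst nat_pow_Suc) (simp add: B_def)
  also have "\<dots> = B \<otimes> b \<otimes> b \<oplus> (x \<otimes> N \<otimes> b \<oplus> x \<otimes> (B \<otimes> b)) \<oplus> x \<otimes> x \<otimes> (N \<oplus> v \<otimes> (b \<oplus> x))"
    by (simp add: cring_simprules)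
  finally show ?case
    unfolding lin' by (intro bexI[of _ "N \<oplus> v \<otimes> (b \<oplus> x)"]) (simp_all add: B_def)
qed

text \<open>
  Put \<open>x = n c\<close> in the expansion above. The linear term carries the factor \<open>p n\<close> because of its
  coefficient \<open>p\<close>, and the remainder carries \<open>n\<^sup>2\<close>, which is a multiple of \<open>n p\<close> because \<open>p\<close>
  divides \<open>n\<close>.
\<close>

lemma (in cring) power_congruence_lift:
  fixes n p :: nat
  assumes [simp]: "b \<in> carrier R" "c \<in> carrier R" and p: "p > 0" "p dvd n"
    and a: "a = b \<oplus> [n] \<cdot> c"
  shows "\<exists>d\<in>carrier R. a [^] p = b [^] p \<oplus> [(n * p)] \<cdot> d"
proof -
  obtain k where k: "p = Suc k"
    using p(1) gr0_conv_Suc by blast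
  obtain q where q: "n = p * q"
    using p(2) by blast
  obtain v where v [simp]: "v \<in> carrier R" and exp: "(b \<oplus> [n] \<cdot> c) [^] p =
    b [^] p \<oplus> [p] \<cdot> ([n] \<cdot> c \<otimes> b [^] k) \<oplus> [n] \<cdot> c \<otimes> [n] \<cdot> c \<otimes> v"
    using binomial_first_order[of b "[n] \<cdot> c" k] by (auto simp: k simp del: nat_pow_Suc add.nat_pow_Suc)
  have "[p] \<cdot> ([n] \<cdot> c \<otimes> b [^] k) = [(n * p)] \<cdot> (c \<otimes> b [^] k)"
    by (simp add: add_pow_ldistr add.nat_pow_pow)
  moreover have "[n] \<cdot> c \<otimes> [n] \<cdot> c \<otimes> v = [(n * p)] \<cdot> ([q] \<cdot> (c \<otimes> c \<otimes> v))"
    by (simp add: add_pow_ldistr add_pow_rdistr add.nat_pow_pow q mult_ac)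
  ultimately have "a [^] p = b [^] p \<oplus> [(n * p)] \<cdot> (c \<otimes> b [^] k \<oplus> [q] \<cdot> (c \<otimes> c \<otimes> v))"
    by (simp add: a exp add.nat_pow_distrib a_assoc)
  then show ?thesis
    by (intro bexI[of _ "c \<otimes> b [^] k \<oplus> [q] \<cdot> (c \<otimes> c \<otimes> v)"]) simp_all
qed

lemma (in cring) iterated_power_congruence_lift:
  fixes p k :: nat
  assumes "b \<in> carrier R" "c \<in> carrier R" and "p > 0" and a: "a = b \<oplus> [p] \<cdot> c"
  shows "\<exists>d\<in>carrier R. a [^] (p ^ k) = b [^] (p ^ k) \<oplus> [(p ^ Suc k)] \<cdot> d"
proof (induction k)
  case 0
  show ?case
    using assms by (auto intro!: bexI[of _ c])
next
  case (Suc k)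
  then obtain d where d: "d \<in> carrier R" "a [^] (p ^ k) = b [^] (p ^ k) \<oplus> [(p ^ Suc k)] \<cdot> d"
    by blast
  have "\<exists>d'\<in>carrier R. (a [^] (p ^ k)) [^] p = (b [^] (p ^ k)) [^] p \<oplus> [(p ^ Suc k * p)] \<cdot> d'"
    by (rule power_congruence_lift) (use assms d in auto)
  moreover have "a \<in> carrier R"
    using assms by simp
  ultimately show ?case
    using assms by (simp add: nat_pow_pow mult_ac)
qed


section \<open>The integral group ring of a finite commutative group\<close>

text \<open>
  For finite \<open>G\<close> finite support is automatic, and the convolution may be summed over the whole
  group; \<open>ZG_mult\<close> puts it in this form, in which substituting \<open>k \<mapsto> h k\<close> in the sums is possible.
\<close>

locale finite_comm_group = comm_group G for G (structure) +
  assumes finite_carrier [simp]: "finite (carrier G)"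
begin

abbreviation ZG where "ZG \<equiv> integral_group_ring G"

lemma ZG_carrier: "carrier ZG = carrier G \<rightarrow>\<^sub>E UNIV"
  by (auto simp: group_ring_def)

lemma ZG_eqI:
  assumes "a \<in> carrier ZG" "b \<in> carrier ZG" "\<And>g. g \<in> carrier G \<Longrightarrow> a g = b g"
  shows "a = b"
  using assms by (auto simp: ZG_carrier intro: PiE_ext)

lemma ZG_add: "g \<in> carrier G \<Longrightarrow> (a \<oplus>\<^bsub>ZG\<^esub> b) g = a g + b g"
  by (simp add: group_ring_def)

lemma ZG_zero: "g \<in> carrier G \<Longrightarrow> \<zero>\<^bsub>ZG\<^esub> g = 0"
  by (simp add: group_ring_def)

lemma ZG_one: "g \<in> carrier G \<Longrightarrow> \<one>\<^bsub>ZG\<^esub> g = (if g = \<one> then 1 else 0)"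
  by (simp add: group_ring_def)

lemma ZG_mult:
  assumes "g \<in> carrier G"
  shows "(a \<otimes>\<^bsub>ZG\<^esub> b) g = (\<Sum>h\<in>carrier G. a h * b (inv h \<otimes> g))"
proof -
  have "(a \<otimes>\<^bsub>ZG\<^esub> b) g = (\<Sum>h\<in>{h \<in> carrier G. a h \<noteq> 0}. a h * b (inv h \<otimes> g))"
    using assms by (simp add: group_ring_def int_finsum_eq)
  also have "\<dots> = (\<Sum>h\<in>carrier G. a h * b (inv h \<otimes> g))"
    by (rule sum.mono_neutral_left) auto
  finally show ?thesis .
qed

lemma ZG_closed:
  "a \<oplus>\<^bsub>ZG\<^esub> b \<in> carrier ZG" "a \<otimes>\<^bsub>ZG\<^esub> b \<in> carrier ZG" "\<zero>\<^bsub>ZG\<^esub> \<in> carrier ZG" "\<one>\<^bsub>ZG\<^esub> \<in> carrier ZG"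
  by (simp_all add: group_ring_def)

lemma ZG_mult_comm: "a \<otimes>\<^bsub>ZG\<^esub> b = b \<otimes>\<^bsub>ZG\<^esub> a"
proof (rule ZG_eqI[OF ZG_closed(2) ZG_closed(2)])
  fix g assume g: "g \<in> carrier G"
  (* h |-> inv h * g is the involution of G that exchanges the two arguments of the convolution. *)
  have invol: "inv (inv k \<otimes> g) \<otimes> g = k" if "k \<in> carrier G" for k
    using g that by (simp add: inv_mult_group m_assoc m_comm[of k g])
      (simp flip: m_assoc)
  have "(\<Sum>h\<in>carrier G. a h * b (inv h \<otimes> g)) = (\<Sum>k\<in>carrier G. a (inv k \<otimes> g) * b k)"
    by (rule sum.reindex_bij_witness[of _ "\<lambda>k. inv k \<otimes> g" "\<lambda>k. inv k \<otimes> g"])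
      (use g in \<open>auto simp: invol\<close>)
  then show "(a \<otimes>\<^bsub>ZG\<^esub> b) g = (b \<otimes>\<^bsub>ZG\<^esub> a) g"
    by (simp add: ZG_mult g mult.commute)
qed

lemma ZG_mult_assoc: "a \<otimes>\<^bsub>ZG\<^esub> b \<otimes>\<^bsub>ZG\<^esub> c = a \<otimes>\<^bsub>ZG\<^esub> (b \<otimes>\<^bsub>ZG\<^esub> c)"
proof (rule ZG_eqI[OF ZG_closed(2) ZG_closed(2)])
  fix g assume g: "g \<in> carrier G"
  have cancel: "inv (inv h \<otimes> k) \<otimes> (inv h \<otimes> g) = inv k \<otimes> g"
    if "h \<in> carrier G" "k \<in> carrier G" for h k
  proof -
    have "inv (inv h \<otimes> k) \<otimes> (inv h \<otimes> g) = inv k \<otimes> (h \<otimes> (inv h \<otimes> g))"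
      using g that by (simp add: inv_mult_group m_assoc)
    also have "h \<otimes> (inv h \<otimes> g) = g"
      using g that by (simp flip: m_assoc)
    finally show ?thesis .
  qed
  have shift: "(\<Sum>k\<in>carrier G. b (inv h \<otimes> k) * c (inv k \<otimes> g)) =
      (\<Sum>k\<in>carrier G. b k * c (inv k \<otimes> (inv h \<otimes> g)))" if h: "h \<in> carrier G" for h
    by (rule sum.reindex_bij_witness[of _ "\<lambda>k. h \<otimes> k" "\<lambda>k. inv h \<otimes> k"])
      (use g h in \<open>simp_all add: cancel, simp_all flip: m_assoc\<close>)
  have "(a \<otimes>\<^bsub>ZG\<^esub> b \<otimes>\<^bsub>ZG\<^esub> c) g =
      (\<Sum>k\<in>carrier G. \<Sum>h\<in>carrier G. a h * (b (inv h \<otimes> k) * c (inv k \<otimes> g)))"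
    by (simp add: ZG_mult g sum_distrib_right mult.assoc)
  also have "\<dots> = (\<Sum>h\<in>carrier G. a h * (\<Sum>k\<in>carrier G. b (inv h \<otimes> k) * c (inv k \<otimes> g)))"
    by (subst sum.swap) (simp add: sum_distrib_left)
  also have "\<dots> = (a \<otimes>\<^bsub>ZG\<^esub> (b \<otimes>\<^bsub>ZG\<^esub> c)) g"
    by (simp add: ZG_mult g shift)
  finally show "(a \<otimes>\<^bsub>ZG\<^esub> b \<otimes>\<^bsub>ZG\<^esub> c) g = (a \<otimes>\<^bsub>ZG\<^esub> (b \<otimes>\<^bsub>ZG\<^esub> c)) g" .
qed

lemma ZG_one_mult:
  assumes "a \<in> carrier ZG"
  shows "\<one>\<^bsub>ZG\<^esub> \<otimes>\<^bsub>ZG\<^esub> a = a"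
proof (rule ZG_eqI[OF ZG_closed(2) assms])
  fix g assume g: "g \<in> carrier G"
  have "(\<one>\<^bsub>ZG\<^esub> \<otimes>\<^bsub>ZG\<^esub> a) g = (\<Sum>h\<in>carrier G. if h = \<one> then a g else 0)"
    unfolding ZG_mult[OF g] by (rule sum.cong) (auto simp: ZG_one g)
  then show "(\<one>\<^bsub>ZG\<^esub> \<otimes>\<^bsub>ZG\<^esub> a) g = a g"
    by simp
qed

lemma ZG_cring: "cring ZG"
proof (intro cringI abelian_groupI comm_monoidI)
  fix a assume "a \<in> carrier ZG"
  have "(\<lambda>g\<in>carrier G. - a g) \<in> carrier ZG"
    by (simp add: ZG_carrier)
  moreover have "(\<lambda>g\<in>carrier G. - a g) \<oplus>\<^bsub>ZG\<^esub> a = \<zero>\<^bsub>ZG\<^esub>"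
    by (rule ZG_eqI) (simp_all add: ZG_closed ZG_add ZG_zero)
  ultimately show "\<exists>b\<in>carrier ZG. b \<oplus>\<^bsub>ZG\<^esub> a = \<zero>\<^bsub>ZG\<^esub>"
    by blast
next
  fix a b c
  show "(a \<oplus>\<^bsub>ZG\<^esub> b) \<otimes>\<^bsub>ZG\<^esub> c = a \<otimes>\<^bsub>ZG\<^esub> c \<oplus>\<^bsub>ZG\<^esub> b \<otimes>\<^bsub>ZG\<^esub> c"
    by (rule ZG_eqI)
      (simp_all add: ZG_closed ZG_mult ZG_add sum.distrib distrib_right)
next
  fix a b c
  show "a \<oplus>\<^bsub>ZG\<^esub> b \<oplus>\<^bsub>ZG\<^esub> c = a \<oplus>\<^bsub>ZG\<^esub> (b \<oplus>\<^bsub>ZG\<^esub> c)"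
    by (rule ZG_eqI) (simp_all add: ZG_closed ZG_add)
next
  fix a b
  show "a \<oplus>\<^bsub>ZG\<^esub> b = b \<oplus>\<^bsub>ZG\<^esub> a"
    by (rule ZG_eqI) (simp_all add: ZG_closed ZG_add)
next
  fix a assume "a \<in> carrier ZG"
  then show "\<zero>\<^bsub>ZG\<^esub> \<oplus>\<^bsub>ZG\<^esub> a = a"
    by (intro ZG_eqI) (simp_all add: ZG_closed ZG_add ZG_zero)
qed (rule ZG_closed ZG_mult_assoc ZG_mult_comm ZG_one_mult | assumption)+

sublocale ZG: cring ZG
  by (rule ZG_cring)

lemma ZG_add_pow:
  assumes "a \<in> carrier ZG" "g \<in> carrier G"
  shows "([n] \<cdot>\<^bsub>ZG\<^esub> a) g = int n * a g"
  using assms by (induction n) (simp_all add: ZG_zero ZG_add ZG.add.nat_pow_Suc distrib_right)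

lemma ZG_finsum:
  assumes "finite I" "\<And>i. i \<in> I \<Longrightarrow> F i \<in> carrier ZG" "g \<in> carrier G"
  shows "(\<Oplus>\<^bsub>ZG\<^esub>i\<in>I. F i) g = (\<Sum>i\<in>I. F i g)"
  using assms by (induction I rule: finite_induct) (simp_all add: ZG_zero ZG_add)


section \<open>Reduction of coefficients\<close>

lemma reduce_eq_iff_cong:
  "reduce_coeffs n G a = reduce_coeffs n G b \<longleftrightarrow> (\<forall>g\<in>carrier G. [a g = b g] (mod int n))"
proof
  assume eq: "reduce_coeffs n G a = reduce_coeffs n G b"
  show "\<forall>g\<in>carrier G. [a g = b g] (mod int n)"
  proof
    fix g assume "g \<in> carrier G"
    then show "[a g = b g] (mod int n)"
      using fun_cong[OF eq, of g] by (simp add: reduce_coeffs_def cong_def)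
  qed
qed (auto simp: reduce_coeffs_def cong_def intro!: restrict_ext)

text \<open>
  This is the bridge from reduction, which is defined on coefficients, to the congruences in
  abstract rings treated above.
\<close>

lemma reduce_eq_iff_add_multiple:
  assumes [simp]: "a \<in> carrier ZG" "b \<in> carrier ZG"
  shows "reduce_coeffs n G a = reduce_coeffs n G b \<longleftrightarrow>
    (\<exists>c\<in>carrier ZG. a = b \<oplus>\<^bsub>ZG\<^esub> [n] \<cdot>\<^bsub>ZG\<^esub> c)"
proof
  assume eq: "reduce_coeffs n G a = reduce_coeffs n G b"
  define c where "c = (\<lambda>g\<in>carrier G. (a g - b g) div int n)"
  have c [simp]: "c \<in> carrier ZG"
    by (simp add: ZG_carrier c_def)
  have "int n dvd a g - b g" if "g \<in> carrier G" for g
    using eq that by (simp add: reduce_eq_iff_cong cong_iff_dvd_diff)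
  then have "a = b \<oplus>\<^bsub>ZG\<^esub> [n] \<cdot>\<^bsub>ZG\<^esub> c"
    by (intro ZG_eqI) (simp_all add: ZG_add ZG_add_pow, simp add: c_def)
  then show "\<exists>c\<in>carrier ZG. a = b \<oplus>\<^bsub>ZG\<^esub> [n] \<cdot>\<^bsub>ZG\<^esub> c"
    using c by blast
qed (auto simp: reduce_eq_iff_cong ZG_add ZG_add_pow cong_def)

lemma reduce_mult_cong:
  assumes "reduce_coeffs n G a = reduce_coeffs n G a'" "reduce_coeffs n G b = reduce_coeffs n G b'"
  shows "reduce_coeffs n G (a \<otimes>\<^bsub>ZG\<^esub> b) = reduce_coeffs n G (a' \<otimes>\<^bsub>ZG\<^esub> b')"
  using assms by (auto simp: reduce_eq_iff_cong ZG_mult intro!: cong_sum cong_mult)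

lemma reduce_reduce:
  assumes "d dvd n"
  shows "reduce_coeffs d G (reduce_coeffs n G a) = reduce_coeffs d G a"
  unfolding reduce_eq_iff_cong using assms by (simp add: reduce_coeffs_def cong_def mod_mod_cancel)

lemma reduce_cong_dvd:
  assumes "reduce_coeffs n G a = reduce_coeffs n G b" "d dvd n"
  shows "reduce_coeffs d G a = reduce_coeffs d G b"
  using reduce_reduce[OF assms(2), of a] reduce_reduce[OF assms(2), of b] assms(1) by simp

lemma reduce_in_ZG [simp]: "reduce_coeffs n G a \<in> carrier ZG"
  by (simp add: ZG_carrier reduce_coeffs_def)

lemma reduce_pow_prime_power_cong:
  assumes "a \<in> carrier ZG" "b \<in> carrier ZG" "p > 0"
    and "reduce_coeffs p G a = reduce_coeffs p G b"
  shows "reduce_coeffs (p ^ Suc k) G (a [^]\<^bsub>ZG\<^esub> (p ^ k)) =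
    reduce_coeffs (p ^ Suc k) G (b [^]\<^bsub>ZG\<^esub> (p ^ k))"
proof -
  obtain c where "c \<in> carrier ZG" "a = b \<oplus>\<^bsub>ZG\<^esub> [p] \<cdot>\<^bsub>ZG\<^esub> c"
    using assms reduce_eq_iff_add_multiple by blast
  then have "\<exists>d\<in>carrier ZG.
      a [^]\<^bsub>ZG\<^esub> (p ^ k) = b [^]\<^bsub>ZG\<^esub> (p ^ k) \<oplus>\<^bsub>ZG\<^esub> [(p ^ Suc k)] \<cdot>\<^bsub>ZG\<^esub> d"
    by (intro ZG.iterated_power_congruence_lift) (use assms in auto)
  then show ?thesis
    using assms reduce_eq_iff_add_multiple[OF ZG.nat_pow_closed ZG.nat_pow_closed] by blast
qed

section \<open>Idempotents modulo n\<close>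

text \<open>
  Residues are represented by the integers \<open>0, \<dots>, n - 1\<close>, so elements of \<open>\<int>\<^sub>nG\<close> are literally
  elements of \<open>\<int>G\<close>, namely those fixed by reduction. This allows statements about \<open>\<int>\<^sub>nG\<close> to be
  moved to \<open>\<int>G\<close> without establishing ring laws for \<open>\<int>\<^sub>nG\<close>.
\<close>

lemma modular_carrier:
  assumes "n \<ge> 2"
  shows "carrier (modular_group_ring n G) = {a \<in> carrier ZG. reduce_coeffs n G a = a}"
proof -
  have C: "carrier (modular_group_ring n G) = carrier G \<rightarrow>\<^sub>E {0..int n - 1}"
    by (auto simp: group_ring_def residue_ring_def)
  have fixed: "reduce_coeffs n G a = a" if "a \<in> carrier G \<rightarrow>\<^sub>E {0..int n - 1}" for a
    using that by (auto simp: reduce_coeffs_def PiE_iff intro!: extensionalityI[of _ "carrier G"])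
  have range: "reduce_coeffs n G a \<in> carrier G \<rightarrow>\<^sub>E {0..int n - 1}" for a
    using assms by (auto simp: reduce_coeffs_def)
  show ?thesis
    unfolding C
  proof (intro equalityI subsetI)
    fix a assume "a \<in> carrier G \<rightarrow>\<^sub>E {0..int n - 1}"
    then show "a \<in> {a \<in> carrier ZG. reduce_coeffs n G a = a}"
      using fixed by (auto simp: ZG_carrier PiE_iff)
  next
    fix a assume "a \<in> {a \<in> carrier ZG. reduce_coeffs n G a = a}"
    then show "a \<in> carrier G \<rightarrow>\<^sub>E {0..int n - 1}"
      using range[of a] by simp
  qed
qed

lemma modular_mult:
  assumes "n \<ge> 2" "a \<in> carrier (modular_group_ring n G)" "b \<in> carrier (modular_group_ring n G)"
  shows "a \<otimes>\<^bsub>modular_group_ring n G\<^esub> b = reduce_coeffs n G (a \<otimes>\<^bsub>ZG\<^esub> b)"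
proof -
  interpret Zn: residues "int n" "residue_ring (int n)"
    using assms by unfold_locales simp_all
  have "(\<Oplus>\<^bsub>residue_ring (int n)\<^esub>h\<in>{h \<in> carrier G. a h \<noteq> 0}. (a h * b (inv h \<otimes> g)) mod int n) =
      (\<Sum>h\<in>carrier G. a h * b (inv h \<otimes> g)) mod int n" for g
  proof (subst Zn.sum_cong)
    show "(\<Sum>h\<in>{h \<in> carrier G. a h \<noteq> 0}. a h * b (inv h \<otimes> g)) mod int n =
        (\<Sum>h\<in>carrier G. a h * b (inv h \<otimes> g)) mod int n"
      by (rule arg_cong[of _ _ "\<lambda>x. x mod int n"], rule sum.mono_neutral_left) auto
  qed simp
  then have "(a \<otimes>\<^bsub>modular_group_ring n G\<^esub> b) g = reduce_coeffs n G (a \<otimes>\<^bsub>ZG\<^esub> b) g" for g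
    by (simp add: group_ring_def[of "residue_ring (int n)"] reduce_coeffs_def ZG_mult
        Zn.res_mult_eq Zn.res_zero_eq)
  then show ?thesis
    by blast
qed

lemma modular_one:
  assumes "n \<ge> 2"
  shows "\<one>\<^bsub>modular_group_ring n G\<^esub> = reduce_coeffs n G \<one>\<^bsub>ZG\<^esub>"
  using assms by (auto simp: group_ring_def residue_ring_def reduce_coeffs_def intro!: restrict_ext)

lemma idempotents_modular:
  assumes n: "n \<ge> 2"
  shows "idempotents (modular_group_ring n G) =
    {e \<in> carrier ZG. reduce_coeffs n G e = e \<and> reduce_coeffs n G (e \<otimes>\<^bsub>ZG\<^esub> e) = e}"
proof -
  have "e [^]\<^bsub>modular_group_ring n G\<^esub> (2::nat) = reduce_coeffs n G (e \<otimes>\<^bsub>ZG\<^esub> e)"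
    if e: "e \<in> carrier (modular_group_ring n G)" for e
  proof -
    have red: "reduce_coeffs n G e = e" "e \<in> carrier ZG"
      using e by (simp_all add: modular_carrier n)
    have one: "\<one>\<^bsub>modular_group_ring n G\<^esub> \<in> carrier (modular_group_ring n G)"
      by (simp add: modular_one modular_carrier n reduce_reduce)
    (* The square is formed as (1 * e) * e by the definition of powers, so the unit law is needed. *)
    have "\<one>\<^bsub>modular_group_ring n G\<^esub> \<otimes>\<^bsub>modular_group_ring n G\<^esub> e =
        reduce_coeffs n G (reduce_coeffs n G \<one>\<^bsub>ZG\<^esub> \<otimes>\<^bsub>ZG\<^esub> e)"
      by (simp only: modular_mult[OF n one e]) (simp only: modular_one[OF n])
    also have "\<dots> = reduce_coeffs n G (\<one>\<^bsub>ZG\<^esub> \<otimes>\<^bsub>ZG\<^esub> e)"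
      by (rule reduce_mult_cong) (simp_all add: reduce_reduce)
    finally have "\<one>\<^bsub>modular_group_ring n G\<^esub> \<otimes>\<^bsub>modular_group_ring n G\<^esub> e = e"
      using red by simp
    then show ?thesis
      by (simp add: numeral_2_eq_2 nat_pow_def modular_mult[OF n e e])
  qed
  then show ?thesis
    by (auto simp: idempotents_def modular_carrier n)
qed

lemma reduce_idempotent_iff:
  assumes "n \<ge> 2"
  shows "reduce_coeffs n G a \<in> idempotents (modular_group_ring n G) \<longleftrightarrow>
    reduce_coeffs n G (a \<otimes>\<^bsub>ZG\<^esub> a) = reduce_coeffs n G a"
  using reduce_mult_cong[of n "reduce_coeffs n G a" a "reduce_coeffs n G a" a] assms
  by (simp add: idempotents_modular reduce_reduce)

lemma reduce_idempotent_pow: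
  assumes "a \<in> carrier ZG" "k > 0" "reduce_coeffs n G (a \<otimes>\<^bsub>ZG\<^esub> a) = reduce_coeffs n G a"
  shows "reduce_coeffs n G (a [^]\<^bsub>ZG\<^esub> (k::nat)) = reduce_coeffs n G a"
  using assms(2)
proof (induction k rule: nat_induct_non_zero)
  case (Suc k)
  have "reduce_coeffs n G (a [^]\<^bsub>ZG\<^esub> k \<otimes>\<^bsub>ZG\<^esub> a) = reduce_coeffs n G (a \<otimes>\<^bsub>ZG\<^esub> a)"
    by (rule reduce_mult_cong) (simp_all add: Suc)
  then show ?case
    using assms by simp
qed (use assms in simp)

text \<open>
  The square of \<open>a\<close> to the power \<open>q\<close> is the power \<open>q\<close> of \<open>a\<^sup>2\<close>, and \<open>a\<^sup>2 \<equiv> a\<close> modulo \<open>p\<close> is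
  sharpened by taking powers with exponent \<open>q = p\<^sup>k\<close>.
\<close>

lemma idempotent_lift_prime_power:
  assumes "a \<in> carrier ZG" "p > 0" "reduce_coeffs p G (a \<otimes>\<^bsub>ZG\<^esub> a) = reduce_coeffs p G a"
  shows "reduce_coeffs (p ^ Suc k) G (a [^]\<^bsub>ZG\<^esub> (p ^ k) \<otimes>\<^bsub>ZG\<^esub> a [^]\<^bsub>ZG\<^esub> (p ^ k)) =
    reduce_coeffs (p ^ Suc k) G (a [^]\<^bsub>ZG\<^esub> (p ^ k))"
  using reduce_pow_prime_power_cong[of "a \<otimes>\<^bsub>ZG\<^esub> a" a p k] assms
  by (simp add: ZG.nat_pow_distrib)

text \<open>
  Taking powers with exponent \<open>p\<^sup>k\<close> turns the congruence of \<open>a\<close> and \<open>b\<close> modulo \<open>p\<close> into one modulo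
  the higher power of \<open>p\<close>, and leaves both classes unchanged there because they are idempotent.
\<close>

lemma idempotent_unique_prime_power:
  assumes ab: "a \<in> carrier ZG" "b \<in> carrier ZG" and "p > 0"
    and "reduce_coeffs (p ^ Suc k) G (a \<otimes>\<^bsub>ZG\<^esub> a) = reduce_coeffs (p ^ Suc k) G a"
    and "reduce_coeffs (p ^ Suc k) G (b \<otimes>\<^bsub>ZG\<^esub> b) = reduce_coeffs (p ^ Suc k) G b"
    and "reduce_coeffs p G a = reduce_coeffs p G b"
  shows "reduce_coeffs (p ^ Suc k) G a = reduce_coeffs (p ^ Suc k) G b"
  using reduce_pow_prime_power_cong[of a b p k] assms
    reduce_idempotent_pow[of a "p ^ k"] reduce_idempotent_pow[of b "p ^ k"]
  by simp

end


section \<open>Gluing over the prime powers dividing the modulus\<close>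

locale prime_power_gluing = finite_comm_group G for G :: "('g, 'y) monoid_scheme" (structure) +
  fixes m j :: nat and p r s :: "nat \<Rightarrow> nat"
  assumes primes: "\<And>i. i \<in> {1..j} \<Longrightarrow> prime (p i)"
    and distinct_primes: "inj_on p {1..j}"
    and exponents: "\<And>i. i \<in> {1..j} \<Longrightarrow> r i \<ge> 1"
    and modulus: "m = (\<Prod>i=1..j. p i ^ r i)"
    and modulus_ge_2: "m \<ge> 2"
    and cofactor_inverse: "\<And>i. i \<in> {1..j} \<Longrightarrow> [s i * (m div p i ^ r i) = 1] (mod p i ^ r i)"
begin

definition glue :: "(nat \<Rightarrow> 'g \<Rightarrow> int) \<Rightarrow> 'g \<Rightarrow> int" where
  "glue f = (\<Oplus>\<^bsub>ZG\<^esub>i\<in>{1..j}.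
     [(s i * (m div p i ^ r i))] \<cdot>\<^bsub>ZG\<^esub> (f i [^]\<^bsub>ZG\<^esub> (p i ^ (r i - 1))))"

lemma prime_power_dvd_modulus: "i \<in> {1..j} \<Longrightarrow> p i ^ r i dvd m"
  unfolding modulus by (rule dvd_prodI) auto

lemma prime_dvd_prime_power: "i \<in> {1..j} \<Longrightarrow> p i dvd p i ^ r i"
  using exponents[of i] by (intro dvd_power) auto

lemma prime_dvd_modulus: "i \<in> {1..j} \<Longrightarrow> p i dvd m"
  using prime_dvd_prime_power prime_power_dvd_modulus dvd_trans by blast

lemma coprime_prime_powers:
  assumes "i \<in> {1..j}" "k \<in> {1..j}" "i \<noteq> k"
  shows "coprime (p i ^ r i) (p k ^ r k)"
  using assms primes distinct_primes by (auto intro!: primes_coprime dest: inj_onD)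

lemma prime_power_dvd_cofactor:
  assumes "i \<in> {1..j}" "k \<in> {1..j}" "i \<noteq> k"
  shows "p i ^ r i dvd m div p k ^ r k"
proof -
  have "m = p k ^ r k * (m div p k ^ r k)"
    using prime_power_dvd_modulus[OF assms(2)] by simp
  then show ?thesis
    using prime_power_dvd_modulus[OF assms(1)] coprime_prime_powers[OF assms]
    by (metis coprime_dvd_mult_right_iff)
qed

lemma reduce_modulus_eq_iff:
  "reduce_coeffs m G a = reduce_coeffs m G b \<longleftrightarrow>
    (\<forall>i\<in>{1..j}. reduce_coeffs (p i ^ r i) G a = reduce_coeffs (p i ^ r i) G b)"
proof
  assume "reduce_coeffs m G a = reduce_coeffs m G b"
  then show "\<forall>i\<in>{1..j}. reduce_coeffs (p i ^ r i) G a = reduce_coeffs (p i ^ r i) G b"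
    using reduce_cong_dvd prime_power_dvd_modulus by blast
next
  assume loc: "\<forall>i\<in>{1..j}. reduce_coeffs (p i ^ r i) G a = reduce_coeffs (p i ^ r i) G b"
  have "[a g = b g] (mod (\<Prod>i\<in>{1..j}. int (p i ^ r i)))" if "g \<in> carrier G" for g
    by (rule cong_cong_prod_coprime)
      (use loc that coprime_prime_powers in \<open>auto simp: reduce_eq_iff_cong coprime_int_iff
        simp del: of_nat_power\<close>)
  then show "reduce_coeffs m G a = reduce_coeffs m G b"
    by (simp add: reduce_eq_iff_cong modulus)
qed

lemma reduce_glue:
  assumes f: "\<And>i. i \<in> {1..j} \<Longrightarrow> f i \<in> carrier ZG" and i: "i \<in> {1..j}"
  shows "reduce_coeffs (p i ^ r i) G (glue f) =
    reduce_coeffs (p i ^ r i) G (f i [^]\<^bsub>ZG\<^esub> (p i ^ (r i - 1)))"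
  unfolding reduce_eq_iff_cong
proof
  fix g assume g: "g \<in> carrier G"
  define F where "F k = f k [^]\<^bsub>ZG\<^esub> (p k ^ (r k - 1))" for k
  define c where "c k = s k * (m div p k ^ r k)" for k
  have "glue f g = (\<Sum>k\<in>{1..j}. int (c k) * F k g)"
    unfolding glue_def using f g by (subst ZG_finsum) (auto simp: ZG_add_pow F_def c_def)
  also have "[\<dots> = (\<Sum>k\<in>{1..j}. if k = i then F i g else 0)] (mod int (p i ^ r i))"
  proof (rule cong_sum)
    fix k assume k: "k \<in> {1..j}"
    show "[int (c k) * F k g = (if k = i then F i g else 0)] (mod int (p i ^ r i))"
    proof (cases "k = i")
      case True
      have "[int (c i) = int 1] (mod int (p i ^ r i))"
        unfolding c_def cong_int_iff by (rule cofactor_inverse[OF i])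
      from cong_scalar_right[OF this, of "F i g"] show ?thesis
        using True by simp
    next
      case False
      have "p i ^ r i dvd c k"
        unfolding c_def using prime_power_dvd_cofactor[OF i k] False by simp
      then have "int (p i ^ r i) dvd int (c k)"
        by (simp only: int_dvd_int_iff)
      with False show ?thesis
        by (simp add: cong_0_iff)
    qed
  qed
  finally show "[glue f g = (f i [^]\<^bsub>ZG\<^esub> (p i ^ (r i - 1))) g] (mod int (p i ^ r i))"
    using i by (simp add: F_def)
qed

lemma reduce_glue_idempotent:
  assumes f: "\<And>i. i \<in> {1..j} \<Longrightarrow> f i \<in> carrier ZG"
    and idem: "\<And>i. i \<in> {1..j} \<Longrightarrow>
      reduce_coeffs (p i) G (f i) \<in> idempotents (modular_group_ring (p i) G)"
  shows "reduce_coeffs m G (glue f) \<in> idempotents (modular_group_ring m G)"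
    and "i \<in> {1..j} \<Longrightarrow> reduce_coeffs (p i) G (glue f) = reduce_coeffs (p i) G (f i)"
proof -
  have idem': "reduce_coeffs (p i) G (f i \<otimes>\<^bsub>ZG\<^esub> f i) = reduce_coeffs (p i) G (f i)"
    if "i \<in> {1..j}" for i
    using idem[OF that] prime_ge_2_nat[OF primes[OF that]] by (simp add: reduce_idempotent_iff)
  have "reduce_coeffs (p i ^ r i) G (glue f \<otimes>\<^bsub>ZG\<^esub> glue f) = reduce_coeffs (p i ^ r i) G (glue f)"
    if i: "i \<in> {1..j}" for i
  proof -
    define F where "F = f i [^]\<^bsub>ZG\<^esub> (p i ^ (r i - 1))"
    have "reduce_coeffs (p i ^ r i) G (F \<otimes>\<^bsub>ZG\<^esub> F) = reduce_coeffs (p i ^ r i) G F"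
      using idempotent_lift_prime_power[of "f i" "p i" "r i - 1"] f[OF i] idem'[OF i]
        prime_gt_0_nat[OF primes[OF i]] exponents[OF i] by (simp add: F_def del: power_Suc)
    then show ?thesis
      using reduce_glue[OF f i] reduce_mult_cong[of "p i ^ r i" "glue f" F "glue f" F]
      by (simp add: F_def)
  qed
  then have "reduce_coeffs m G (glue f \<otimes>\<^bsub>ZG\<^esub> glue f) = reduce_coeffs m G (glue f)"
    using reduce_modulus_eq_iff by blast
  then show "reduce_coeffs m G (glue f) \<in> idempotents (modular_group_ring m G)"
    by (simp add: reduce_idempotent_iff modulus_ge_2)
  assume i: "i \<in> {1..j}"
  have "reduce_coeffs (p i) G (glue f) = reduce_coeffs (p i) G (f i [^]\<^bsub>ZG\<^esub> (p i ^ (r i - 1)))"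
    by (rule reduce_cong_dvd[OF reduce_glue prime_dvd_prime_power]) (use f i in auto)
  also have "\<dots> = reduce_coeffs (p i) G (f i)"
    by (rule reduce_idempotent_pow) (use f i idem' prime_gt_0_nat[OF primes[OF i]] in simp_all)
  finally show "reduce_coeffs (p i) G (glue f) = reduce_coeffs (p i) G (f i)" .
qed

text \<open>
  Injectivity: reductions modulo the primes determine an idempotent modulo each prime power, by
  uniqueness of lifts, and therefore modulo \<open>m\<close>. Surjectivity: members of the tuple are their own
  representatives in \<open>\<int>G\<close>, and gluing them gives a preimage.
\<close>

lemma bij_betw_idempotents:
  "bij_betw (\<lambda>e. \<lambda>i\<in>{1..j}. reduce_coeffs (p i) G e) (idempotents (modular_group_ring m G))
    (\<Pi>\<^sub>E i\<in>{1..j}. idempotents (modular_group_ring (p i) G))"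
  unfolding bij_betw_def
proof
  note p2 = prime_ge_2_nat[OF primes]
  note em = idempotents_modular[OF modulus_ge_2]
  have idem_mod: "reduce_coeffs d G (e \<otimes>\<^bsub>ZG\<^esub> e) = reduce_coeffs d G e"
    if "e \<in> idempotents (modular_group_ring m G)" "d dvd m" for d e
    by (rule reduce_cong_dvd[of m]) (use that in \<open>simp_all add: em\<close>)
  show "inj_on (\<lambda>e. \<lambda>i\<in>{1..j}. reduce_coeffs (p i) G e) (idempotents (modular_group_ring m G))"
  proof (rule inj_onI)
    fix a b
    assume a: "a \<in> idempotents (modular_group_ring m G)"
      and b: "b \<in> idempotents (modular_group_ring m G)"
      and eq: "(\<lambda>i\<in>{1..j}. reduce_coeffs (p i) G a) = (\<lambda>i\<in>{1..j}. reduce_coeffs (p i) G b)"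
    have "reduce_coeffs (p i ^ r i) G a = reduce_coeffs (p i ^ r i) G b" if i: "i \<in> {1..j}" for i
    proof -
      have "reduce_coeffs (p i) G a = reduce_coeffs (p i) G b"
        using fun_cong[OF eq, of i] i by simp
      then show ?thesis
        using idempotent_unique_prime_power[of a b "p i" "r i - 1"] a b
          idem_mod[OF a prime_power_dvd_modulus[OF i]] idem_mod[OF b prime_power_dvd_modulus[OF i]]
          prime_gt_0_nat[OF primes[OF i]] exponents[OF i] by (simp add: em del: power_Suc)
    qed
    then have "reduce_coeffs m G a = reduce_coeffs m G b"
      using reduce_modulus_eq_iff by blast
    then show "a = b"
      using a b by (simp add: em)
  qed
  show "(\<lambda>e. \<lambda>i\<in>{1..j}. reduce_coeffs (p i) G e) ` idempotents (modular_group_ring m G) =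
    (\<Pi>\<^sub>E i\<in>{1..j}. idempotents (modular_group_ring (p i) G))"
  proof (intro equalityI subsetI)
    fix x assume "x \<in> (\<lambda>e. \<lambda>i\<in>{1..j}. reduce_coeffs (p i) G e) ` idempotents (modular_group_ring m G)"
    then obtain e where e: "e \<in> idempotents (modular_group_ring m G)"
      and x: "x = (\<lambda>i\<in>{1..j}. reduce_coeffs (p i) G e)"
      by blast
    have "reduce_coeffs (p i) G e \<in> idempotents (modular_group_ring (p i) G)" if i: "i \<in> {1..j}" for i
      using idem_mod[OF e prime_dvd_modulus[OF i]] by (simp add: reduce_idempotent_iff[OF p2[OF i]])
    then show "x \<in> (\<Pi>\<^sub>E i\<in>{1..j}. idempotents (modular_group_ring (p i) G))"
      by (simp add: x)
  next
    fix x assume x: "x \<in> (\<Pi>\<^sub>E i\<in>{1..j}. idempotents (modular_group_ring (p i) G))"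
    have xi: "x i \<in> carrier ZG" "reduce_coeffs (p i) G (x i) = x i"
      "reduce_coeffs (p i) G (x i) \<in> idempotents (modular_group_ring (p i) G)" if i: "i \<in> {1..j}" for i
      using PiE_mem[OF x i] by (simp_all add: idempotents_modular[OF p2[OF i]])
    define e where "e = reduce_coeffs m G (glue x)"
    have "e \<in> idempotents (modular_group_ring m G)"
      unfolding e_def by (rule reduce_glue_idempotent(1)) (use xi in auto)
    moreover have "reduce_coeffs (p i) G e = x i" if i: "i \<in> {1..j}" for i
      using reduce_glue_idempotent(2)[of x i] xi i prime_dvd_modulus[OF i]
      by (simp add: e_def reduce_reduce)
    then have "(\<lambda>i\<in>{1..j}. reduce_coeffs (p i) G e) = restrict x {1..j}"
      by (rule restrict_ext)
    then have "x = (\<lambda>i\<in>{1..j}. reduce_coeffs (p i) G e)"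
      by (simp only: PiE_restrict[OF x])
    ultimately show "x \<in> (\<lambda>e. \<lambda>i\<in>{1..j}. reduce_coeffs (p i) G e) ` idempotents (modular_group_ring m G)"
      by blast
  qed
qed

end

theorem theorem4p11:
  fixes G :: "('g, 'y) monoid_scheme" and m j :: nat and p r s :: "nat \<Rightarrow> nat"
  assumes "comm_group G" and "finite (carrier G)"
    and "m \<ge> 2"
    and "\<And>i. i \<in> {1..j} \<Longrightarrow> prime (p i)"
    and "inj_on p {1..j}"
    and "\<And>i. i \<in> {1..j} \<Longrightarrow> r i \<ge> 1"
    and "m = (\<Prod>i=1..j. p i ^ r i)"
    and "\<And>i. i \<in> {1..j} \<Longrightarrow> [s i * (m div p i ^ r i) = 1] (mod p i ^ r i)"
  shows "(\<forall>fbar f :: nat \<Rightarrow> 'g \<Rightarrow> int.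
      (\<forall>i\<in>{1..j}. fbar i \<in> idempotents (modular_group_ring (p i) G) \<and>
         f i \<in> carrier (integral_group_ring G) \<and> reduce_coeffs (p i) G (f i) = fbar i) \<longrightarrow>
      reduce_coeffs m G
        (\<Oplus>\<^bsub>integral_group_ring G\<^esub>i\<in>{1..j}.
          [(s i * (m div p i ^ r i))] \<cdot>\<^bsub>integral_group_ring G\<^esub>
            (f i [^]\<^bsub>integral_group_ring G\<^esub> (p i ^ (r i - 1))))
      \<in> idempotents (modular_group_ring m G))
    \<and> card (idempotents (modular_group_ring m G)) =
      (\<Prod>i=1..j. card (idempotents (modular_group_ring (p i) G)))"
proof -
  interpret comm_group G
    by (rule assms(1))
  interpret prime_power_gluing G m j p r s
    by unfold_locales (fact assms)+
  have "card (idempotents (modular_group_ring m G)) =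
      (\<Prod>i=1..j. card (idempotents (modular_group_ring (p i) G)))"
    using bij_betw_same_card[OF bij_betw_idempotents] by (simp add: card_PiE)
  moreover have "reduce_coeffs m G
      (\<Oplus>\<^bsub>ZG\<^esub>i\<in>{1..j}. [(s i * (m div p i ^ r i))] \<cdot>\<^bsub>ZG\<^esub> (f i [^]\<^bsub>ZG\<^esub> (p i ^ (r i - 1))))
      \<in> idempotents (modular_group_ring m G)"
    if "\<forall>i\<in>{1..j}. fbar i \<in> idempotents (modular_group_ring (p i) G) \<and>
      f i \<in> carrier ZG \<and> reduce_coeffs (p i) G (f i) = fbar i" for fbar f
    using reduce_glue_idempotent(1)[of f] that by (simp add: glue_def)
  ultimately show ?thesis
    by blast
qed

end
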